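(* Let $L$ be a sublattice of $2^{[r]}$ (i.e. a family of subsets of $[r]$ closed under union and intersection) that contains both $\emptyset$ and $[r]$. (1) There is a rank-$r$ transversal matroid $M$ and a maximal presentation $\mathcal{A}$ of $M$ with $L=L_\mathcal{A}$. (2) For any $n\ge r$, there is a presentation $\mathcal{B}$ of the uniform matroid $U_{r,n}$ with $L=L_\mathcal{B}$.
   Context: $[r]=\{1,\dots,r\}$. For a set system $\mathcal{A}=(A_i:i\in[r])$ on a finite set $E$, $M[\mathcal{A}]$ is the transversal matroid on $E$ whose independent sets are the partial transversals of $\mathcal{A}$ (sets $X$ admitting an injection $\phi:X\to[r]$ with $e\in A_{\phi(e)}$); $\mathcal{A}$ is a presentation of $M[\mathcal{A}]$; presentations of a rank-$r$ matroid have exactly $r$ sets. Presentations of $M$ are ordered by $(A_i)\preceq(B_i)$ iff $A_i\subseteq B_i$ for all $i$; maximal means maximal in this order. Fix $x\notin E$; for $I\subseteq[r]$, $\mathcal{A}^I$ is obtained from $\mathcal{A}$ by replacing $A_i$ by $A_i\cup\{x\}$ for each $i\in I$. Let $\sigma_\mathcal{A}(I)=I\cup\{k\in[r]-I: x\text{ is a coloop of } M[\mathcal{A}^I]\backslash A_k\}$; $L_\mathcal{A}$ is the set of $I\subseteq[r]$ with $\sigma_\mathcal{A}(I)=I$. *)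

theory Defs
  imports Main
begin

text \<open>A matroid is represented by the pair of its ground set and its collection of
  independent sets; the axioms are the predicate \<open>is_matroid\<close>.\<close>

type_synonym 'a matroid_data = "'a set \<times> 'a set set"

definition ground :: "'a matroid_data \<Rightarrow> 'a set" where
  "ground M = fst M"

definition indeps :: "'a matroid_data \<Rightarrow> 'a set set" where
  "indeps M = snd M"

definition is_matroid :: "'a matroid_data \<Rightarrow> bool" where
  "is_matroid M \<longleftrightarrow>
     finite (ground M) \<and>
     indeps M \<subseteq> Pow (ground M) \<and>
     {} \<in> indeps M \<and>
     (\<forall>Y\<in>indeps M. \<forall>X. X \<subseteq> Y \<longrightarrow> X \<in> indeps M) \<and>
     (\<forall>X\<in>indeps M. \<forall>Y\<in>indeps M. card X < card Y \<longrightarrow>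
        (\<exists>y\<in>Y - X. insert y X \<in> indeps M))"

definition mrank :: "'a matroid_data \<Rightarrow> nat" where
  "mrank M = Max (card ` indeps M)"

definition is_basis :: "'a matroid_data \<Rightarrow> 'a set \<Rightarrow> bool" where
  "is_basis M B \<longleftrightarrow> B \<in> indeps M \<and> (\<forall>B'\<in>indeps M. B \<subseteq> B' \<longrightarrow> B' = B)"

definition coloop :: "'a matroid_data \<Rightarrow> 'a \<Rightarrow> bool" where
  "coloop M e \<longleftrightarrow> e \<in> ground M \<and> (\<forall>B. is_basis M B \<longrightarrow> e \<in> B)"

definition deletion :: "'a matroid_data \<Rightarrow> 'a set \<Rightarrow> 'a matroid_data" where
  "deletion M D = (ground M - D, {X \<in> indeps M. X \<subseteq> ground M - D})"

definition uniform_matroid :: "nat \<Rightarrow> 'a set \<Rightarrow> 'a matroid_data" where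
  "uniform_matroid r E = (E, {X. X \<subseteq> E \<and> card X \<le> r})"

text \<open>A set system \<open>(A\<^sub>i : i \<in> [r])\<close> is a function on \<open>nat\<close> of which only the values at
  \<open>1, \<dots>, r\<close> matter.\<close>

definition set_system :: "'a set \<Rightarrow> nat \<Rightarrow> (nat \<Rightarrow> 'a set) \<Rightarrow> bool" where
  "set_system E r A \<longleftrightarrow> finite E \<and> (\<forall>i\<in>{1..r}. A i \<subseteq> E)"

definition partial_transversal :: "nat \<Rightarrow> (nat \<Rightarrow> 'a set) \<Rightarrow> 'a set \<Rightarrow> bool" where
  "partial_transversal r A X \<longleftrightarrow>
     (\<exists>\<phi>. inj_on \<phi> X \<and> \<phi> ` X \<subseteq> {1..r} \<and> (\<forall>e\<in>X. e \<in> A (\<phi> e)))"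

definition transversal_matroid :: "'a set \<Rightarrow> nat \<Rightarrow> (nat \<Rightarrow> 'a set) \<Rightarrow> 'a matroid_data" where
  "transversal_matroid E r A = (E, {X. X \<subseteq> E \<and> partial_transversal r A X})"

definition is_transversal_matroid :: "'a matroid_data \<Rightarrow> bool" where
  "is_transversal_matroid M \<longleftrightarrow>
     (\<exists>s A. set_system (ground M) s A \<and> M = transversal_matroid (ground M) s A)"

text \<open>Presentations are required to have as many sets as the rank of the matroid.\<close>

definition presentation :: "nat \<Rightarrow> (nat \<Rightarrow> 'a set) \<Rightarrow> 'a matroid_data \<Rightarrow> bool" where
  "presentation r A M \<longleftrightarrow>
     mrank M = r \<and> set_system (ground M) r A \<and> M = transversal_matroid (ground M) r A"

definition sys_le :: "nat \<Rightarrow> (nat \<Rightarrow> 'a set) \<Rightarrow> (nat \<Rightarrow> 'a set) \<Rightarrow> bool" where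
  "sys_le r A B \<longleftrightarrow> (\<forall>i\<in>{1..r}. A i \<subseteq> B i)"

definition maximal_presentation :: "nat \<Rightarrow> (nat \<Rightarrow> 'a set) \<Rightarrow> 'a matroid_data \<Rightarrow> bool" where
  "maximal_presentation r A M \<longleftrightarrow>
     presentation r A M \<and>
     (\<forall>B. presentation r B M \<and> sys_le r A B \<longrightarrow> (\<forall>i\<in>{1..r}. B i = A i))"

definition extend_system :: "'a \<Rightarrow> nat set \<Rightarrow> (nat \<Rightarrow> 'a set) \<Rightarrow> nat \<Rightarrow> 'a set" where
  "extend_system x I A = (\<lambda>i. if i \<in> I then insert x (A i) else A i)"

text \<open>In the next two definitions, \<open>x\<close> is meant to lie outside \<open>E\<close>, and the extended system lives
  on the ground set \<open>insert x E\<close>.\<close>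

definition sigma_op :: "'a set \<Rightarrow> nat \<Rightarrow> 'a \<Rightarrow> (nat \<Rightarrow> 'a set) \<Rightarrow> nat set \<Rightarrow> nat set" where
  "sigma_op E r x A I = I \<union> {k \<in> {1..r} - I.
     coloop (deletion (transversal_matroid (insert x E) r (extend_system x I A)) (A k)) x}"

definition closed_sets :: "'a set \<Rightarrow> nat \<Rightarrow> 'a \<Rightarrow> (nat \<Rightarrow> 'a set) \<Rightarrow> nat set set" where
  "closed_sets E r x A = {I. I \<subseteq> {1..r} \<and> sigma_op E r x A I = I}"

definition sublattice_of_subsets :: "nat \<Rightarrow> nat set set \<Rightarrow> bool" where
  "sublattice_of_subsets r L \<longleftrightarrow>
     L \<subseteq> Pow {1..r} \<and> (\<forall>I\<in>L. \<forall>J\<in>L. I \<union> J \<in> L \<and> I \<inter> J \<in> L)"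

lemma is_matroidI:
  assumes "finite E" and "P {}"
    and "\<And>X Y. X \<subseteq> Y \<Longrightarrow> Y \<subseteq> E \<Longrightarrow> P Y \<Longrightarrow> P X"
    and "\<And>X Y. X \<subseteq> E \<Longrightarrow> P X \<Longrightarrow> Y \<subseteq> E \<Longrightarrow> P Y \<Longrightarrow> card X < card Y \<Longrightarrow>
           \<exists>y\<in>Y - X. P (insert y X)"
  shows "is_matroid (E, {X. X \<subseteq> E \<and> P X})"
  unfolding is_matroid_def ground_def indeps_def fst_conv snd_conv
proof (intro conjI ballI allI impI)
  show "X \<in> {X. X \<subseteq> E \<and> P X}" if "Y \<in> {X. X \<subseteq> E \<and> P X}" "X \<subseteq> Y" for X Y
    using that assms(3)[of X Y] by auto
  show "\<exists>y\<in>Y - X. insert y X \<in> {X. X \<subseteq> E \<and> P X}"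
    if "X \<in> {X. X \<subseteq> E \<and> P X}" "Y \<in> {X. X \<subseteq> E \<and> P X}" "card X < card Y" for X Y
  proof -
    have "\<exists>y\<in>Y - X. P (insert y X)"
      using that by (intro assms(4)) simp_all
    then obtain y where "y \<in> Y - X" "P (insert y X)" by (rule bexE)
    then show ?thesis using that(1,2) by (intro bexI[of _ y]) auto
  qed
qed (use assms(1,2) in auto)

lemma partial_transversal_subset:
  assumes "partial_transversal r A Y" "X \<subseteq> Y"
  shows "partial_transversal r A X"
proof -
  obtain \<phi> where \<phi>: "inj_on \<phi> Y" "\<phi> ` Y \<subseteq> {1..r}" "\<forall>e\<in>Y. e \<in> A (\<phi> e)"
    using assms(1) unfolding partial_transversal_def by blast
  have "inj_on \<phi> X" using \<phi>(1) assms(2) by (rule inj_on_subset)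
  moreover have "\<phi> ` X \<subseteq> {1..r}" using \<phi>(2) assms(2) by blast
  moreover have "\<forall>e\<in>X. e \<in> A (\<phi> e)" using \<phi>(3) assms(2) by blast
  ultimately show ?thesis unfolding partial_transversal_def by blast
qed

lemma partial_transversal_augment:
  assumes fin: "finite X" "finite Y" and lt: "card X < card Y"
    and \<psi>: "inj_on \<psi> Y" "\<psi> ` Y \<subseteq> {1..r}" "\<forall>e\<in>Y. e \<in> A (\<psi> e)"
    and \<phi>: "inj_on \<phi> X" "\<phi> ` X \<subseteq> {1..r}" "\<forall>e\<in>X. e \<in> A (\<phi> e)"
  shows "\<exists>y\<in>Y - X. partial_transversal r A (insert y X)"
  using \<phi>
proof (induction "card {e \<in> X \<inter> Y. \<phi> e \<noteq> \<psi> e}" arbitrary: \<phi> rule: less_induct)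
  case less
  have "card (\<phi> ` X) < card (\<psi> ` Y)"
    using less.prems(1) \<psi>(1) lt by (simp add: card_image)
  then have "\<not> \<psi> ` Y \<subseteq> \<phi> ` X"
    using fin by (meson card_mono finite_imageI not_le)
  then obtain y where y: "y \<in> Y" "\<psi> y \<notin> \<phi> ` X" by blast
  define \<phi>' where "\<phi>' = \<phi>(y := \<psi> y)"
  have inj: "inj_on \<phi>' (insert y X)"
  proof (rule inj_onI)
    fix a b assume ab: "a \<in> insert y X" "b \<in> insert y X" "\<phi>' a = \<phi>' b"
    show "a = b"
    proof (cases "a = y \<or> b = y")
      case True
      have "\<phi> c \<noteq> \<psi> y" if "c \<in> X" for c using y(2) that by (metis imageI)
      then show ?thesis using True ab by (fastforce simp: \<phi>'_def split: if_splits)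
    next
      case False
      then have "a \<in> X" "b \<in> X" "\<phi> a = \<phi> b" using ab by (auto simp: \<phi>'_def)
      then show ?thesis using less.prems(1) by (simp add: inj_on_eq_iff)
    qed
  qed
  have rng: "\<phi>' ` insert y X \<subseteq> {1..r}"
  proof (rule image_subsetI)
    fix a assume "a \<in> insert y X"
    then show "\<phi>' a \<in> {1..r}"
      using subsetD[OF less.prems(2), of "\<phi> a"] subsetD[OF \<psi>(2), of "\<psi> y"] y(1)
      by (cases "a = y") (simp_all add: \<phi>'_def)
  qed
  have mem: "\<forall>e\<in>insert y X. e \<in> A (\<phi>' e)"
    using less.prems(3) \<psi>(3) y(1) by (simp add: \<phi>'_def)
  show ?case
  proof (cases "y \<in> X")
    case False
    then show ?thesis
      using inj rng mem y(1) unfolding partial_transversal_def by blast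
  next
    case True
    have "{e \<in> X \<inter> Y. \<phi>' e \<noteq> \<psi> e} \<subset> {e \<in> X \<inter> Y. \<phi> e \<noteq> \<psi> e}"
    proof (rule psubsetI)
      show "{e \<in> X \<inter> Y. \<phi>' e \<noteq> \<psi> e} \<subseteq> {e \<in> X \<inter> Y. \<phi> e \<noteq> \<psi> e}"
        by (auto simp: \<phi>'_def split: if_splits)
      have "\<phi> y \<noteq> \<psi> y" using True y(2) by (metis imageI)
      then have "y \<in> {e \<in> X \<inter> Y. \<phi> e \<noteq> \<psi> e}" using True y(1) by simp
      moreover have "y \<notin> {e \<in> X \<inter> Y. \<phi>' e \<noteq> \<psi> e}" by (simp add: \<phi>'_def)
      ultimately show "{e \<in> X \<inter> Y. \<phi>' e \<noteq> \<psi> e} \<noteq> {e \<in> X \<inter> Y. \<phi> e \<noteq> \<psi> e}" by metis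
    qed
    then have "card {e \<in> X \<inter> Y. \<phi>' e \<noteq> \<psi> e} < card {e \<in> X \<inter> Y. \<phi> e \<noteq> \<psi> e}"
      using fin by (intro psubset_card_mono) auto
    then show ?thesis
      using less.hyps[of \<phi>'] inj rng mem unfolding insert_absorb[OF True] by blast
  qed
qed

lemma is_matroid_transversal_matroid:
  assumes "set_system E r A"
  shows "is_matroid (transversal_matroid E r A)"
  unfolding transversal_matroid_def
proof (rule is_matroidI)
  show fin: "finite E" using assms by (simp add: set_system_def)
  show "partial_transversal r A {}" by (simp add: partial_transversal_def)
  show "partial_transversal r A X" if "X \<subseteq> Y" "partial_transversal r A Y" for X Y
    using partial_transversal_subset[OF that(2,1)] .
  show "\<exists>y\<in>Y - X. partial_transversal r A (insert y X)"
    if X: "X \<subseteq> E" "partial_transversal r A X"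
      and Y: "Y \<subseteq> E" "partial_transversal r A Y" and lt: "card X < card Y" for X Y
  proof -
    have fXY: "finite X" "finite Y" using fin X(1) Y(1) finite_subset by auto
    obtain \<phi> where \<phi>: "inj_on \<phi> X" "\<phi> ` X \<subseteq> {1..r}" "\<forall>e\<in>X. e \<in> A (\<phi> e)"
      using X(2) unfolding partial_transversal_def by blast
    obtain \<psi> where \<psi>: "inj_on \<psi> Y" "\<psi> ` Y \<subseteq> {1..r}" "\<forall>e\<in>Y. e \<in> A (\<psi> e)"
      using Y(2) unfolding partial_transversal_def by blast
    show ?thesis
      by (rule partial_transversal_augment[OF fXY lt \<psi> \<phi>])
  qed
qed

lemma is_matroid_uniform_matroid:
  assumes "finite E"
  shows "is_matroid (uniform_matroid r E)"
  unfolding uniform_matroid_def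
proof (rule is_matroidI)
  show "card X \<le> r" if "X \<subseteq> Y" "Y \<subseteq> E" "card Y \<le> r" for X Y
    using card_mono[OF finite_subset[OF that(2) assms] that(1)] that(3) by linarith
  show "\<exists>y\<in>Y - X. card (insert y X) \<le> r"
    if "X \<subseteq> E" "card Y \<le> r" "card X < card Y" for X Y
  proof -
    have fX: "finite X" using finite_subset[OF that(1) assms] .
    then have "\<not> Y \<subseteq> X" using that(3) card_mono[OF fX, of Y] by linarith
    then obtain y where y: "y \<in> Y - X" by blast
    then have "card (insert y X) \<le> r" using that(2,3) fX by simp
    then show ?thesis using y by blast
  qed
qed (use assms in auto)

end

theory Submission imports Defs begin

text \<open>For \<open>i \<in> [r]\<close> let \<open>U i\<close> be the least member of \<open>L\<close> containing \<open>i\<close>; then \<open>L\<close> consists of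
  the \<open>I \<subseteq> [r]\<close> with \<open>U i \<subseteq> I\<close> for all \<open>i \<in> I\<close>. Take elements \<open>e\<^sub>1, \<dots>, e\<^sub>r\<close> and put \<open>e\<^sub>i\<close> into
  exactly the sets \<open>A\<^sub>l\<close> with \<open>l \<in> U i\<close>. Given \<open>k\<close>, let \<open>J\<close> be the set of \<open>j\<close> with \<open>k \<notin> U j\<close>.
  The elements outside \<open>A\<^sub>k\<close> can only be matched into \<open>J\<close>, and the \<open>e\<^sub>j\<close> with \<open>j \<in> J\<close> fill up \<open>J\<close>.
  Hence \<open>x\<close> is a coloop of \<open>M[A\<^sup>I]\A\<^sub>k\<close> iff \<open>I\<close> is not contained in \<open>J\<close>, that is, \<open>\<sigma>(I)\<close> is the
  union of the \<open>U i\<close> with \<open>i \<in> I\<close>. This does not change if further elements are added, as long as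
  the indices of the sets containing each of them form a member of \<open>L\<close>. Doubling every \<open>e\<^sub>i\<close> makes
  the presentation maximal, and adding elements that lie in all sets yields a uniform matroid.\<close>

section \<open>Partial transversals and presentations\<close>

lemma partial_transversal_card_le:
  assumes "partial_transversal r A X"
  shows "card X \<le> r"
proof -
  obtain \<phi> where "inj_on \<phi> X" "\<phi> ` X \<subseteq> {1..r}"
    using assms unfolding partial_transversal_def by blast
  then show ?thesis using card_inj_on_le[of \<phi> X "{1..r}"] by simp
qed

text \<open>\<open>V e\<close> collects the indices of the sets that contain \<open>e\<close>, and
  \<open>\<iota> i\<close> is the distinguished element with index set \<open>U i\<close>. Elements
  outside the range of \<open>\<iota>\<close> only need an index set closed under \<open>U\<close>,
  so that both constructions are instances. Taking \<open>e = \<iota> i\<close> in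
  \<open>U_subset_V\<close> gives transitivity of \<open>U\<close>.\<close>

locale closure_system =
  fixes r :: nat and U :: "nat \<Rightarrow> nat set" and E :: "'a set"
    and V :: "'a \<Rightarrow> nat set" and \<iota> :: "nat \<Rightarrow> 'a"
  assumes finite_E: "finite E"
    and V_subset: "e \<in> E \<Longrightarrow> V e \<subseteq> {1..r}"
    and U_subset_V: "e \<in> E \<Longrightarrow> j \<in> V e \<Longrightarrow> U j \<subseteq> V e"
    and refl_U: "i \<in> {1..r} \<Longrightarrow> i \<in> U i"
    and inj_\<iota>: "inj_on \<iota> {1..r}"
    and \<iota>_mem: "i \<in> {1..r} \<Longrightarrow> \<iota> i \<in> E"
    and V_\<iota>: "i \<in> {1..r} \<Longrightarrow> V (\<iota> i) = U i"
begin

definition A :: "nat \<Rightarrow> 'a set" where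
  "A l = {e \<in> E. l \<in> V e}"

definition J :: "nat \<Rightarrow> nat set" where
  "J k = {j \<in> {1..r}. k \<notin> U j}"

lemma finite_J: "finite (J k)"
  by (simp add: J_def)

lemma set_system_A: "set_system E r A"
  using finite_E by (auto simp: set_system_def A_def)

text \<open>If \<open>k\<close> were in \<open>U l\<close>, then \<open>U l \<subseteq> V e\<close>
  would put \<open>e\<close> into \<open>A k\<close>.\<close>

lemma matched_into_J:
  assumes "e \<in> E - A k" "e \<in> A l"
  shows "l \<in> J k"
  using assms V_subset[of e] U_subset_V[of e l] by (auto simp: A_def J_def)

lemma \<iota>_J_outside: "\<iota> ` J k \<subseteq> E - A k"
  using \<iota>_mem V_\<iota> by (auto simp: J_def A_def)

text \<open>Since \<open>i \<in> U i\<close>, each \<open>\<iota> i\<close> can be matched to its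
  own index. This is used for \<open>K = {1..r}\<close> and for \<open>K = J k\<close>.\<close>

lemma inv_into_\<iota>:
  assumes "K \<subseteq> {1..r}"
  shows "inj_on (inv_into {1..r} \<iota>) (\<iota> ` K)" "inv_into {1..r} \<iota> ` (\<iota> ` K) = K"
    "\<forall>e\<in>\<iota> ` K. e \<in> A (inv_into {1..r} \<iota> e)"
proof -
  show "inj_on (inv_into {1..r} \<iota>) (\<iota> ` K)"
    by (intro inj_on_inv_into image_mono assms)
  show "inv_into {1..r} \<iota> ` (\<iota> ` K) = K"
    by (rule inv_into_image_cancel[OF inj_\<iota> assms])
  show "\<forall>e\<in>\<iota> ` K. e \<in> A (inv_into {1..r} \<iota> e)"
  proof (intro ballI)
    fix e assume "e \<in> \<iota> ` K"
    then obtain i where i: "i \<in> K" "e = \<iota> i" by blast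
    then have "i \<in> {1..r}" using assms by blast
    then show "e \<in> A (inv_into {1..r} \<iota> e)"
      using i inj_\<iota> \<iota>_mem V_\<iota> refl_U by (simp add: A_def)
  qed
qed

lemma mrank_transversal_matroid: "mrank (transversal_matroid E r A) = r"
proof -
  let ?I = "{X. X \<subseteq> E \<and> partial_transversal r A X}"
  have "partial_transversal r A (\<iota> ` {1..r})"
    unfolding partial_transversal_def using inv_into_\<iota>[OF order_refl]
    by (intro exI[of _ "inv_into {1..r} \<iota>"] conjI) simp_all
  then have "\<iota> ` {1..r} \<in> ?I" using \<iota>_mem by (simp add: image_subset_iff)
  moreover have "card (\<iota> ` {1..r}) = r"
    using inj_\<iota> by (simp add: card_image)
  ultimately have "r \<in> card ` ?I" by (intro image_eqI[of _ card "\<iota> ` {1..r}"]) simp_all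
  moreover have "finite (card ` ?I)" using finite_E by simp
  moreover have "n \<le> r" if "n \<in> card ` ?I" for n
    using that partial_transversal_card_le by blast
  ultimately have "Max (card ` ?I) = r" by (intro Max_eqI)
  then show ?thesis by (simp add: mrank_def transversal_matroid_def indeps_def)
qed

lemma presentation_transversal_matroid: "presentation r A (transversal_matroid E r A)"
  using mrank_transversal_matroid set_system_A
  by (simp add: presentation_def transversal_matroid_def ground_def)

text \<open>Without \<open>x\<close>, the rank outside \<open>A k\<close> is
  \<open>card (J k)\<close>. Adding \<open>x\<close> raises it exactly if \<open>x\<close> can use
  an index outside \<open>J k\<close>.\<close>

lemma coloop_iff:
  assumes x: "x \<notin> E" and I: "I \<subseteq> {1..r}" and k: "k \<in> {1..r} - I"
  shows "coloop (deletion (transversal_matroid (insert x E) r (extend_system x I A)) (A k)) x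
    \<longleftrightarrow> (\<exists>i\<in>I. k \<in> U i)" (is "coloop ?N x \<longleftrightarrow> _")
proof -
  let ?D = "insert x (E - A k)"
  have xA: "x \<notin> A l" for l using x by (simp add: A_def)
  have ground: "ground ?N = ?D"
    using xA by (auto simp: deletion_def transversal_matroid_def ground_def)
  have indep: "X \<in> indeps ?N \<longleftrightarrow> X \<subseteq> ?D \<and> partial_transversal r (extend_system x I A) X" for X
    using xA by (auto simp: deletion_def transversal_matroid_def ground_def indeps_def)
  have ext: "e \<in> extend_system x I A l \<longleftrightarrow> (if e = x then l \<in> I else e \<in> A l)" for e l
    using xA by (auto simp: extend_system_def)
  have xin: "x \<in> ground ?N" using ground by simp
  show ?thesis
  proof
    assume "\<exists>i\<in>I. k \<in> U i"
    then obtain i where i: "i \<in> I" "k \<in> U i" by blast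
    have "x \<in> B" if B: "is_basis ?N B" for B
    proof (rule ccontr)
      assume xB: "x \<notin> B"
      have "B \<in> indeps ?N" using B by (simp add: is_basis_def)
      then have BD: "B \<subseteq> ?D" and "partial_transversal r (extend_system x I A) B"
        by (simp_all add: indep)
      then obtain \<phi> where \<phi>: "inj_on \<phi> B" "\<phi> ` B \<subseteq> {1..r}"
          "\<forall>e\<in>B. e \<in> extend_system x I A (\<phi> e)"
        unfolding partial_transversal_def by blast
      \<comment> \<open>As \<open>B\<close> avoids \<open>x\<close>, all of it is matched into
        \<open>J k\<close>. This leaves \<open>i\<close> free for \<open>x\<close>, against the
        maximality of \<open>B\<close>.\<close>
      have "\<phi> e \<in> J k" if "e \<in> B" for e
      proof (rule matched_into_J)
        show "e \<in> E - A k" using that BD xB by blast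
        have "e \<noteq> x" using that xB by blast
        then show "e \<in> A (\<phi> e)" using bspec[OF \<phi>(3) that] ext by simp
      qed
      then have "i \<notin> \<phi> ` B" using i(2) by (auto simp: J_def)
      have "partial_transversal r (extend_system x I A) (insert x B)"
        unfolding partial_transversal_def
      proof (intro exI[of _ "\<phi>(x := i)"] conjI)
        show "inj_on (\<phi>(x := i)) (insert x B)"
          using \<phi>(1) \<open>i \<notin> \<phi> ` B\<close> xB by (auto simp: inj_on_def)
        show "\<phi>(x := i) ` insert x B \<subseteq> {1..r}"
          using \<phi>(2) i(1) I by auto
        show "\<forall>e\<in>insert x B. e \<in> extend_system x I A ((\<phi>(x := i)) e)"
          using \<phi>(3) i(1) by (auto simp: ext)
      qed
      then have "insert x B \<in> indeps ?N" using BD by (simp add: indep)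
      then have "insert x B = B" using B by (auto simp: is_basis_def)
      then show False using xB by blast
    qed
    then show "coloop ?N x" using xin by (simp add: coloop_def)
  next
    assume col: "coloop ?N x"
    show "\<exists>i\<in>I. k \<in> U i"
    proof (rule ccontr)
      assume "\<not> (\<exists>i\<in>I. k \<in> U i)"
      then have IJ: "I \<subseteq> J k" using I by (auto simp: J_def)
      have Jr: "J k \<subseteq> {1..r}" by (auto simp: J_def)
      \<comment> \<open>This is a basis avoiding \<open>x\<close>: now \<open>x\<close> too can only
        be matched into \<open>J k\<close>, which \<open>?T\<close> already fills.\<close>
      let ?T = "\<iota> ` J k"
      have xT: "x \<notin> ?T" using \<iota>_J_outside x by blast
      have "\<forall>e\<in>?T. e \<in> extend_system x I A (inv_into {1..r} \<iota> e)"
        using inv_into_\<iota>(3)[OF Jr] by (simp add: extend_system_def)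
      then have "partial_transversal r (extend_system x I A) ?T"
        using inv_into_\<iota>(1,2)[OF Jr] Jr unfolding partial_transversal_def
        by (intro exI[of _ "inv_into {1..r} \<iota>"] conjI) simp_all
      then have T: "?T \<in> indeps ?N" using \<iota>_J_outside by (auto simp: indep)
      have "B = ?T" if B: "B \<in> indeps ?N" and TB: "?T \<subseteq> B" for B
      proof -
        have BD: "B \<subseteq> ?D" using B by (simp add: indep)
        then have fin: "finite B" using finite_E finite_subset by fastforce
        obtain \<phi> where \<phi>: "inj_on \<phi> B" "\<forall>e\<in>B. e \<in> extend_system x I A (\<phi> e)"
          using B unfolding indep partial_transversal_def by blast
        have "\<phi> e \<in> J k" if "e \<in> B" for e
        proof (cases "e = x")
          case True
          then show ?thesis using bspec[OF \<phi>(2) that] ext IJ by auto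
        next
          case False
          then have "e \<in> E - A k" "e \<in> A (\<phi> e)"
            using bspec[OF \<phi>(2) that] that BD by (auto simp: ext)
          then show ?thesis by (rule matched_into_J)
        qed
        then have "card B \<le> card (J k)"
          using \<phi>(1) finite_J by (intro card_inj_on_le[of \<phi>]) auto
        also have "\<dots> = card ?T"
          using inj_on_subset[OF inj_\<iota> Jr] by (simp add: card_image)
        finally show ?thesis using card_seteq[OF fin TB] by simp
      qed
      then have "is_basis ?N ?T" using T by (simp add: is_basis_def)
      then show False using col xT by (simp add: coloop_def)
    qed
  qed
qed

lemma closed_sets_eq:
  assumes "x \<notin> E" "\<And>i. i \<in> {1..r} \<Longrightarrow> U i \<subseteq> {1..r}"
  shows "closed_sets E r x A = {I. I \<subseteq> {1..r} \<and> (\<forall>i\<in>I. U i \<subseteq> I)}"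
proof -
  have "sigma_op E r x A I = I \<longleftrightarrow> (\<forall>i\<in>I. U i \<subseteq> I)" if I: "I \<subseteq> {1..r}" for I
  proof -
    have "sigma_op E r x A I = I \<union> {k \<in> {1..r} - I. \<exists>i\<in>I. k \<in> U i}"
      unfolding sigma_op_def using coloop_iff[OF assms(1) I] by (simp cong: conj_cong)
    \<comment> \<open>Each \<open>U i\<close> lies in \<open>{1..r}\<close>, so after the union with
      \<open>I\<close> the restriction on \<open>k\<close> makes no difference.\<close>
    also have "\<dots> = I \<union> (\<Union>i\<in>I. U i)" using assms(2) I by fastforce
    finally show ?thesis
      by (simp add: Un_commute[of I] subset_Un_eq[symmetric] UN_subset_iff)
  qed
  then show ?thesis unfolding closed_sets_def by (simp cong: conj_cong)
qed

text \<open>\<open>c e\<close> is the index of which \<open>e\<close> is a copy. If a larger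
  presentation put a new \<open>e\<close> into the set with index \<open>i\<close>, then
  \<open>e\<close> and copies of the indices in \<open>J i\<close>, chosen different from
  \<open>e\<close>, would form an independent set outside \<open>A i\<close> with more than
  \<open>card (J i)\<close> elements.\<close>

lemma maximal_presentation_transversal_matroid:
  assumes copy: "\<And>e j. e \<in> E \<Longrightarrow> j \<in> {1..r} \<Longrightarrow> \<exists>e'\<in>E. e' \<noteq> e \<and> c e' = j"
    and V_c: "\<And>e. e \<in> E \<Longrightarrow> V e = U (c e)"
  shows "maximal_presentation r A (transversal_matroid E r A)"
  unfolding maximal_presentation_def
proof (intro conjI allI impI ballI presentation_transversal_matroid)
  fix B i assume B: "presentation r B (transversal_matroid E r A) \<and> sys_le r A B"
    and i: "i \<in> {1..r}"
  have le: "A j \<subseteq> B j" if "j \<in> {1..r}" for j using B that by (simp add: sys_le_def)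
  have BE: "B i \<subseteq> E"
    using B i by (simp add: presentation_def set_system_def transversal_matroid_def ground_def)
  have eq: "partial_transversal r A X \<longleftrightarrow> partial_transversal r B X" if "X \<subseteq> E" for X
    using B that by (auto simp: presentation_def transversal_matroid_def ground_def)
  have Jr: "J i \<subseteq> {1..r}" by (auto simp: J_def)
  have "B i \<subseteq> A i"
  proof
    fix e assume e: "e \<in> B i"
    show "e \<in> A i"
    proof (rule ccontr)
      assume eA: "e \<notin> A i"
      have eE: "e \<in> E" using e BE by blast
      have "\<forall>j\<in>J i. \<exists>e'\<in>E. e' \<noteq> e \<and> c e' = j" using copy[OF eE] Jr by blast
      then obtain g where g: "\<And>j. j \<in> J i \<Longrightarrow> g j \<in> E \<and> g j \<noteq> e \<and> c (g j) = j" by metis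
      let ?X = "insert e (g ` J i)"
      have inj_g: "inj_on g (J i)" using g by (metis inj_onI)
      have e_notin: "e \<notin> g ` J i" using g by blast
      have iJ: "i \<notin> J i" using refl_U i by (simp add: J_def)
      have g_A: "g j \<in> A j" if "j \<in> J i" for j
        using g[OF that] V_c[of "g j"] refl_U Jr that by (auto simp: A_def)
      have g_out: "g j \<in> E - A i" if "j \<in> J i" for j
        using g[OF that] V_c[of "g j"] that by (auto simp: A_def J_def)
      have "partial_transversal r B ?X"
        unfolding partial_transversal_def
      \<comment> \<open>The copies \<open>g j\<close> keep their indices \<open>j \<in> J i\<close>,
        and \<open>e\<close> takes \<open>i\<close>, which is not in \<open>J i\<close>.\<close>
      proof (intro exI[of _ "c(e := i)"] conjI)
        show "inj_on (c(e := i)) ?X"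
          using g iJ e_notin by (auto simp: inj_on_def)
        show "c(e := i) ` ?X \<subseteq> {1..r}" using g i Jr by auto
        show "\<forall>a\<in>?X. a \<in> B ((c(e := i)) a)"
        proof
          fix a assume "a \<in> ?X"
          then consider "a = e" | j where "j \<in> J i" "a = g j" "a \<noteq> e" using e_notin by blast
          then show "a \<in> B ((c(e := i)) a)"
          proof cases
            case 2
            then have "a \<in> B j" using g_A le Jr by blast
            then show ?thesis using 2 g by simp
          qed (use e in simp)
        qed
      qed
      moreover have "?X \<subseteq> E" using g eE by blast
      ultimately have "partial_transversal r A ?X" using eq by blast
      then obtain \<phi> where \<phi>: "inj_on \<phi> ?X" "\<forall>a\<in>?X. a \<in> A (\<phi> a)"
        unfolding partial_transversal_def by blast
      have "?X \<subseteq> E - A i" using g_out eE eA by blast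
      then have "\<phi> ` ?X \<subseteq> J i" using \<phi>(2) matched_into_J by blast
      then have "card ?X \<le> card (J i)"
        using \<phi>(1) finite_J by (intro card_inj_on_le[of \<phi>]) auto
      moreover have "card ?X = Suc (card (J i))"
        using e_notin finite_J inj_g by (simp add: card_image)
      ultimately show False by simp
    qed
  qed
  then show "B i = A i" using le i by blast
qed

end

lemma partial_transversal_uniform:
  assumes X: "finite X" "card X \<le> r" and B: "bij_betw \<psi> Y {1..r}" "\<forall>e\<in>Y. e \<in> A (\<psi> e)"
    and rest: "\<And>e i. e \<in> X - Y \<Longrightarrow> i \<in> {1..r} \<Longrightarrow> e \<in> A i"
  shows "partial_transversal r A X"
proof -
  let ?R = "{1..r} - \<psi> ` (X \<inter> Y)"
  have inj: "inj_on \<psi> (X \<inter> Y)" using B(1) by (auto simp: bij_betw_def inj_on_def)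
  have im: "\<psi> ` (X \<inter> Y) \<subseteq> {1..r}" using B(1) by (auto simp: bij_betw_def)
  have "card (X - Y) = card X - card (X \<inter> Y)"
    using X(1) by (simp add: card_Diff_subset_Int)
  also have "\<dots> \<le> r - card (X \<inter> Y)" using X(2) by simp
  also have "\<dots> = card ?R"
    using im X(1) inj by (simp add: card_Diff_subset card_image)
  finally obtain \<chi> where \<chi>: "inj_on \<chi> (X - Y)" "\<chi> ` (X - Y) \<subseteq> ?R"
    using card_le_inj[of "X - Y" ?R] X(1) by auto
  let ?f = "\<lambda>e. if e \<in> Y then \<psi> e else \<chi> e"
  have "inj_on ?f X"
  proof (rule inj_onI)
    fix a b assume ab: "a \<in> X" "b \<in> X" "?f a = ?f b"
    show "a = b"
      using ab \<chi> inj by (cases "a \<in> Y"; cases "b \<in> Y") (fastforce simp: inj_on_def)+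
  qed
  moreover have "?f ` X \<subseteq> {1..r}" using im \<chi>(2) by auto
  moreover have "\<forall>e\<in>X. e \<in> A (?f e)" using B(2) rest \<chi>(2) by (auto simp: image_subset_iff)
  ultimately show ?thesis unfolding partial_transversal_def by blast
qed

section \<open>Least members of a finite lattice of sets\<close>

definition least_member :: "'a set set \<Rightarrow> 'a \<Rightarrow> 'a set" where
  "least_member L i = \<Inter>{I \<in> L. i \<in> I}"

text \<open>\<open>L\<close> is finite, hence closed under finite unions and nonempty finite
  intersections. That \<open>{1..r} \<in> L\<close> makes the family defining
  \<open>least_member L i\<close> nonempty, and \<open>{} \<in> L\<close> covers the empty union. A
  set closed under \<open>least_member L\<close> is the union of the least members of its
  elements.\<close>

lemma sublattice_least_member:
  assumes L: "sublattice_of_subsets r L" "{} \<in> L" "{1..r} \<in> L"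
  shows least_member_in: "i \<in> {1..r} \<Longrightarrow> least_member L i \<in> L"
    and sublattice_eq: "L = {I. I \<subseteq> {1..r} \<and> (\<forall>i\<in>I. least_member L i \<subseteq> I)}"
proof -
  have sub: "L \<subseteq> Pow {1..r}" and un: "\<And>I J. I \<in> L \<Longrightarrow> J \<in> L \<Longrightarrow> I \<union> J \<in> L"
    and int: "\<And>I J. I \<in> L \<Longrightarrow> J \<in> L \<Longrightarrow> I \<inter> J \<in> L"
    using L(1) by (auto simp: sublattice_of_subsets_def)
  have fin: "finite L" using sub finite_subset by blast
  have Inter: "\<Inter>F \<in> L" if "finite F" "F \<noteq> {}" "F \<subseteq> L" for F
    using that by (induction F rule: finite_ne_induct) (auto intro: int)
  have Union: "\<Union>F \<in> L" if "finite F" "F \<subseteq> L" for F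
    using that by (induction F rule: finite_induct) (auto intro: un L(2))
  show mem: "least_member L i \<in> L" if "i \<in> {1..r}" for i
    unfolding least_member_def by (rule Inter) (use fin L(3) that in auto)
  show "L = {I. I \<subseteq> {1..r} \<and> (\<forall>i\<in>I. least_member L i \<subseteq> I)}"
  proof (intro set_eqI iffI)
    fix I assume "I \<in> L"
    then show "I \<in> {I. I \<subseteq> {1..r} \<and> (\<forall>i\<in>I. least_member L i \<subseteq> I)}"
      using sub by (auto simp: least_member_def)
  next
    fix I assume "I \<in> {I. I \<subseteq> {1..r} \<and> (\<forall>i\<in>I. least_member L i \<subseteq> I)}"
    then have I: "I \<subseteq> {1..r}" "\<And>i. i \<in> I \<Longrightarrow> least_member L i \<subseteq> I" by auto
    have "\<Union>(least_member L ` I) \<in> L"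
      using I(1) mem by (intro Union) (auto intro: finite_subset)
    moreover have "\<Union>(least_member L ` I) = I"
      using I(2) by (auto simp: least_member_def)
    ultimately show "I \<in> L" by simp
  qed
qed

section \<open>The two constructions: doubled elements and elements in all sets\<close>

theorem theorem3p19:
  fixes r :: nat and L :: "nat set set"
  assumes "sublattice_of_subsets r L"
    and "{} \<in> L" and "{1..r} \<in> L"
  shows "(\<exists>M :: nat matroid_data. is_matroid M \<and> is_transversal_matroid M \<and> mrank M = r \<and>
            (\<exists>A. maximal_presentation r A M \<and>
                 (\<forall>x. x \<notin> ground M \<longrightarrow> L = closed_sets (ground M) r x A)))
       \<and> (\<forall>n\<ge>r. \<forall>E :: 'a set. finite E \<and> card E = n \<longrightarrow>
            (\<exists>B. presentation r B (uniform_matroid r E) \<and>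
                 (\<forall>x. x \<notin> E \<longrightarrow> L = closed_sets E r x B)))"
proof (intro conjI allI impI)
  let ?U = "least_member L"
  have U_mem: "?U i \<in> L" if "i \<in> {1..r}" for i
    by (rule least_member_in[OF assms that])
  have U_sub: "?U i \<subseteq> {1..r}" if "i \<in> {1..r}" for i
    using U_mem[OF that] assms(1) by (auto simp: sublattice_of_subsets_def)
  have U_refl: "i \<in> ?U i" for i by (simp add: least_member_def)
  have U_least: "?U j \<subseteq> I" if "I \<in> L" "j \<in> I" for I j
    using that by (auto simp: least_member_def)
  note L_eq = sublattice_eq[OF assms]
  show "\<exists>M :: nat matroid_data. is_matroid M \<and> is_transversal_matroid M \<and> mrank M = r \<and>
      (\<exists>A. maximal_presentation r A M \<and>
        (\<forall>x. x \<notin> ground M \<longrightarrow> L = closed_sets (ground M) r x A))"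
  proof -
    \<comment> \<open>The two copies of \<open>e\<^sub>i\<close> are \<open>2 * i\<close> and \<open>2 * i + 1\<close>.\<close>
    let ?E = "{e::nat. e div 2 \<in> {1..r}}"
    interpret closure_system r ?U ?E "\<lambda>e. ?U (e div 2)" "\<lambda>i. 2 * i"
    proof
      have "?E \<subseteq> {..2 * r + 1}" by auto
      then show "finite ?E" by (rule finite_subset) simp
    next
      fix e assume "e \<in> ?E"
      then have e: "e div 2 \<in> {1..r}" by simp
      show "?U (e div 2) \<subseteq> {1..r}" by (rule U_sub[OF e])
      show "?U j \<subseteq> ?U (e div 2)" if "j \<in> ?U (e div 2)" for j
        by (rule U_least[OF U_mem[OF e] that])
    qed (use U_refl in \<open>auto simp: inj_on_def\<close>)
    let ?M = "transversal_matroid ?E r A"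
    have ground: "ground ?M = ?E" by (simp add: transversal_matroid_def ground_def)
    have "maximal_presentation r A ?M"
    proof (rule maximal_presentation_transversal_matroid[where c = "\<lambda>e. e div 2"])
      fix e j :: nat assume "j \<in> {1..r}"
      then show "\<exists>e'\<in>?E. e' \<noteq> e \<and> e' div 2 = j"
        \<comment> \<open>The even copy of \<open>j\<close> serves unless it is \<open>e\<close>
          itself.\<close>
        by (intro bexI[of _ "if e = 2 * j then 2 * j + 1 else 2 * j"]) auto
    qed simp
    moreover have "L = closed_sets ?E r x A" if "x \<notin> ?E" for x
      by (rule trans[OF L_eq closed_sets_eq[OF that U_sub, symmetric]])
    moreover have "is_transversal_matroid ?M"
      unfolding is_transversal_matroid_def ground using set_system_A by blast
    ultimately show ?thesis
      using is_matroid_transversal_matroid[OF set_system_A] mrank_transversal_matroid ground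
      by metis
  qed
  fix n :: nat and E :: "'a set" assume n: "r \<le> n" and E: "finite E \<and> card E = n"
  obtain \<iota> where \<iota>: "inj_on \<iota> {1..r}" "\<iota> ` {1..r} \<subseteq> E"
    using card_le_inj[of "{1..r}" E] n E by auto
  \<comment> \<open>The \<open>n - r\<close> remaining elements lie in every set. Their index set
    \<open>{1..r}\<close> belongs to \<open>L\<close>, so they do not affect the closed
    sets.\<close>
  define V where "V e = (if e \<in> \<iota> ` {1..r} then ?U (inv_into {1..r} \<iota> e) else {1..r})" for e
  have V_in: "V e \<in> L" for e
    using U_mem[OF inv_into_into[of e \<iota> "{1..r}"]] assms(3)
    by (cases "e \<in> \<iota> ` {1..r}") (simp_all only: V_def if_True if_False)
  interpret closure_system r ?U E V \<iota>
  proof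
    show "V e \<subseteq> {1..r}" for e
      using V_in[of e] assms(1) by (auto simp: sublattice_of_subsets_def)
    show "?U j \<subseteq> V e" if "j \<in> V e" for e j
      using U_least[OF V_in that] .
    show "V (\<iota> i) = ?U i" if "i \<in> {1..r}" for i
      using that \<iota>(1) by (simp add: V_def)
  qed (use \<iota> E U_refl in auto)
  have uniform: "partial_transversal r A X \<longleftrightarrow> card X \<le> r" if X: "X \<subseteq> E" for X
  proof
    show "partial_transversal r A X \<Longrightarrow> card X \<le> r"
      by (rule partial_transversal_card_le)
  next
    assume "card X \<le> r"
    then show "partial_transversal r A X"
    proof (rule partial_transversal_uniform[rotated])
      show "finite X" using X E finite_subset by blast
      show "bij_betw (inv_into {1..r} \<iota>) (\<iota> ` {1..r}) {1..r}"
        using inv_into_\<iota>(1,2)[OF order_refl] by (rule bij_betw_imageI)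
      show "\<forall>e\<in>\<iota> ` {1..r}. e \<in> A (inv_into {1..r} \<iota> e)"
        by (rule inv_into_\<iota>(3)) simp
      show "e \<in> A i" if "e \<in> X - \<iota> ` {1..r}" "i \<in> {1..r}" for e i
        using that X by (auto simp: A_def V_def)
    qed
  qed
  then have "uniform_matroid r E = transversal_matroid E r A"
    by (auto simp: uniform_matroid_def transversal_matroid_def)
  then have "presentation r A (uniform_matroid r E)"
    using presentation_transversal_matroid by simp
  moreover have "L = closed_sets E r x A" if "x \<notin> E" for x
    by (rule trans[OF L_eq closed_sets_eq[OF that U_sub, symmetric]])
  ultimately show "\<exists>B. presentation r B (uniform_matroid r E) \<and>
      (\<forall>x. x \<notin> E \<longrightarrow> L = closed_sets E r x B)" by blast
qed

end
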